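(* Let $f\in\mathcal{F}'$ be of infinite $*$-order. The following statements are equivalent: (i) $\int_0^1|f^{n*}(x)-1|^2\,dx\to0$ as $n\to\infty$ (i.e. $f^{n*}\to1$ in $L_2$); (ii) for all $r>0$, $\int_0^1|f^{n*}(x)-1|^r\,dx\to0$ as $n\to\infty$ (i.e. $f^{n*}\to1$ in $L_r$); (iii) $\dfrac{\mu_n\,\mu_{n+2}}{\mu_{n+1}^2}\to1$ as $n\to\infty$.
   Context: $\mathcal{F}'$ is the class of cumulative distribution functions $F$ on $\mathbb{R}$ that are absolutely continuous with respect to Lebesgue measure and whose density $f=F'$ is positive (almost everywhere on the support of $F$, and zero outside the support). We write $f\in\mathcal{F}'$ for the density of such an $F$. For such $F$, the quantile function is $Q(u)=\inf\{x: F(x)\ge u\}$, $0<u<1$. If $\kappa_0=\int_{-\infty}^{\infty} f(x)^2\,dx<\infty$, the probability density quantile (pdQ) of $f$ is the probability density on $(0,1)$ given by $f^*(u)=f(Q(u))/\kappa_0$, $0<u<1$; if $\kappa_0=\infty$, $f^*$ does not exist. Iterates: $f^{1*}=f^*$ and $f^{(n+1)*}=(f^{n*})^*$ for $n\ge1$. That is, with $\kappa_n=\int_0^1 \{f^{n*}(x)\}^2\,dx$ and $Q^{n*}$ the quantile function of the distribution with density $f^{n*}$, $f^{(n+1)*}(u)=f^{n*}(Q^{n*}(u))/\kappa_n$ for $0<u<1$; it exists if and only if $f^{n*}$ exists and $\kappa_n<\infty$. $f$ is of infinite $*$-order if $f^{n*}$ exists for every $n\ge1$. For $n\ge1$, $\mu_n=\int_{-\infty}^{\infty}\{f(y)\}^n\,dy$,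 the integrand being $0$ outside the support. *)

theory Defs
  imports "HOL-Probability.Probability"
begin

abbreviation density_cdf :: "(real \<Rightarrow> real) \<Rightarrow> real \<Rightarrow> real" where
  "density_cdf f \<equiv> cdf (density lborel (\<lambda>x. ennreal (f x)))"

text \<open>The topological support of a distribution, in terms of its distribution function
  (the set of points of increase).\<close>

definition cdf_support :: "(real \<Rightarrow> real) \<Rightarrow> real set" where
  "cdf_support F = {x. \<forall>e>0. F (x - e) < F (x + e)}"

text \<open>The class \<open>\<F>'\<close>, described by densities: an absolutely continuous distribution function
  is one of the form \<^term>\<open>density_cdf f\<close>. Every Borel version \<open>f\<close> of the density that
  satisfies the positivity requirements is admitted.\<close>

definition positive_densities :: "(real \<Rightarrow> real) set" where
  "positive_densities = {f. f \<in> borel_measurable borel \<and> (\<forall>x. 0 \<le> f x) \<and>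
     prob_space (density lborel (\<lambda>x. ennreal (f x))) \<and>
     (AE x in lborel. x \<in> cdf_support (density_cdf f) \<longrightarrow> 0 < f x) \<and>
     (\<forall>x. x \<notin> cdf_support (density_cdf f) \<longrightarrow> f x = 0)}"

definition quantile :: "(real \<Rightarrow> real) \<Rightarrow> real \<Rightarrow> real" where
  "quantile F u = Inf {x. u \<le> F x}"

definition power_integral :: "(real \<Rightarrow> real) \<Rightarrow> nat \<Rightarrow> ennreal" where
  "power_integral f n = (\<integral>\<^sup>+y. ennreal (f y ^ n) \<partial>lborel)"

text \<open>The normalising constant is \<open>\<kappa> = \<integral>f\<^sup>2\<close>, i.e. \<^term>\<open>power_integral f 2\<close>. The pdQ is
  a density on \<open>(0,1)\<close>, extended by \<open>0\<close> to the real line; the formula is meaningful only if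
  \<open>\<kappa> < \<infinity>\<close>, which is recorded separately in \<open>pdQ_iter_exists\<close>.\<close>

definition pdQ :: "(real \<Rightarrow> real) \<Rightarrow> real \<Rightarrow> real" where
  "pdQ f u = (if 0 < u \<and> u < 1
     then f (quantile (density_cdf f) u) / enn2real (power_integral f 2) else 0)"

definition pdQ_iter :: "nat \<Rightarrow> (real \<Rightarrow> real) \<Rightarrow> real \<Rightarrow> real" where
  "pdQ_iter n f = (pdQ ^^ n) f"

primrec pdQ_iter_exists :: "nat \<Rightarrow> (real \<Rightarrow> real) \<Rightarrow> bool" where
  "pdQ_iter_exists 0 f \<longleftrightarrow> True"
| "pdQ_iter_exists (Suc n) f \<longleftrightarrow> pdQ_iter_exists n f \<and> power_integral (pdQ_iter n f) 2 < \<infinity>"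

definition infinite_star_order :: "(real \<Rightarrow> real) \<Rightarrow> bool" where
  "infinite_star_order f \<longleftrightarrow> (\<forall>n\<ge>1. pdQ_iter_exists n f)"

end

theory Submission
  imports Defs
begin

text \<open>
  If \<open>U\<close> is uniform on \<open>(0,1)\<close> then \<open>Q U\<close> has density \<open>f\<close>; hence, inductively, \<open>f\<^sup>n\<^sup>*(U)\<close> has the
  law of \<open>f / c\<^sub>n\<close> under the probability measure with density \<open>f\<^sup>n / \<mu>\<^sub>n\<close>, where
  \<open>c\<^sub>n = \<mu>\<^sub>n\<^sub>+\<^sub>1 / \<mu>\<^sub>n\<close>. So the \<open>k\<close>-th moment of \<open>f\<^sup>n\<^sup>*\<close> is \<open>\<mu>\<^sub>n\<^sub>+\<^sub>k / (\<mu>\<^sub>n c\<^sub>n\<^sup>k)\<close>; it is \<open>1\<close>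
  for \<open>k = 1\<close> and the quotient in (iii) for \<open>k = 2\<close>, and their difference is the integral in (i). If
  that quotient \<open>c\<^sub>n\<^sub>+\<^sub>1 / c\<^sub>n\<close> tends to \<open>1\<close>, then so does every moment, being a product of quotients
  \<open>c\<^sub>n\<^sub>+\<^sub>j / c\<^sub>n\<close>; by the binomial theorem all even central moments tend to \<open>0\<close>, and these dominate
  the absolute ones of any order \<open>r > 0\<close>.
\<close>

section \<open>Probability densities and the uniform law on the unit interval\<close>

abbreviation unit_measure :: "real measure" where
  "unit_measure \<equiv> restrict_space lborel {0<..<1}"

lemma prob_space_unit_measure: "prob_space unit_measure"
  by (auto simp: space_restrict_space emeasure_restrict_space intro!: prob_spaceI)

text \<open>The invariant of the iteration: \<open>pdQ\<close> preserves it as long as the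
  normalising constant is finite.\<close>

definition is_density :: "(real \<Rightarrow> real) \<Rightarrow> bool" where
  "is_density g \<longleftrightarrow> g \<in> borel_measurable borel \<and> (\<forall>x. 0 \<le> g x) \<and>
     prob_space (density lborel (\<lambda>x. ennreal (g x)))"

lemma is_density_iff:
  "is_density g \<longleftrightarrow> g \<in> borel_measurable borel \<and> (\<forall>x. 0 \<le> g x) \<and> power_integral g 1 = 1"
  unfolding is_density_def power_integral_def
  by (auto simp: emeasure_density intro!: prob_spaceI dest!: prob_space.emeasure_space_1)

lemma is_densityD:
  assumes "is_density g"
  shows "g \<in> borel_measurable borel" "0 \<le> g x"
    "(\<integral>\<^sup>+x. ennreal (g x) \<partial>lborel) = 1"
  using assms by (auto simp: is_density_iff power_integral_def)

text \<open>If the integral vanished, \<open>g\<close> would be 0 almost everywhere and could not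
  have mass 1. This makes every normalising constant a legitimate divisor.\<close>

lemma power_integral_pos:
  assumes "is_density g" "0 < n"
  shows "0 < power_integral g n"
proof (rule ccontr)
  note [measurable] = is_densityD(1)[OF assms(1)]
  assume "\<not> 0 < power_integral g n"
  then have "(\<integral>\<^sup>+x. ennreal (g x ^ n) \<partial>lborel) = 0"
    by (simp add: power_integral_def)
  then have "AE x in lborel. ennreal (g x ^ n) = 0"
    by (subst (asm) nn_integral_0_iff_AE) auto
  then have "AE x in lborel. ennreal (g x) = 0"
  proof eventually_elim
    case (elim x)
    have "0 \<le> g x" by (rule is_densityD(2)[OF assms(1)])
    moreover from this have "g x ^ n = 0" using elim by (metis ennreal_eq_0_iff order.antisym zero_le_power)
    ultimately show ?case by simp
  qed
  then have "(\<integral>\<^sup>+x. ennreal (g x) \<partial>lborel) = 0"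
    by (subst nn_integral_0_iff_AE) auto
  with is_densityD(3)[OF assms(1)] show False by simp
qed

section \<open>The quantile transform and a single application of \<open>pdQ\<close>\<close>

lemma quantile_measurable_and_distr:
  assumes "is_density g"
  shows "quantile (density_cdf g) \<in> borel_measurable unit_measure"
    and "distr unit_measure borel (quantile (density_cdf g)) = density lborel (\<lambda>x. ennreal (g x))"
proof -
  interpret prob_space "density lborel (\<lambda>x. ennreal (g x))"
    using assms by (simp add: is_density_def)
  interpret cdf_distribution "density lborel (\<lambda>x. ennreal (g x))"
    by standard auto
  \<comment> \<open>\<open>I\<close> is the generalised inverse that the locale
    \<open>cdf_distribution\<close> provides; it is given by the same infimum.\<close>
  have *: "quantile (density_cdf g) = I"
    by (simp add: quantile_def fun_eq_iff)
  show "quantile (density_cdf g) \<in> borel_measurable unit_measure"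
    unfolding * using measurable_CI
    by (simp cong: measurable_cong_sets add: sets_restrict_space_cong[of lborel borel])
  show "distr unit_measure borel (quantile (density_cdf g)) = density lborel (\<lambda>x. ennreal (g x))"
    unfolding * by (rule distr_I_eq_M)
qed

lemma pdQ_measurable:
  assumes "is_density g"
  shows "pdQ g \<in> borel_measurable borel"
proof -
  note [measurable] = is_densityD(1)[OF assms] quantile_measurable_and_distr(1)[OF assms]
  have "(\<lambda>u. g (quantile (density_cdf g) u) / enn2real (power_integral g 2)) \<in> borel_measurable unit_measure"
    by measurable
  then have "(\<lambda>u. if u \<in> {0<..<1} then g (quantile (density_cdf g) u) / enn2real (power_integral g 2) else 0)
      \<in> borel_measurable lborel"
    by (subst measurable_restrict_space_iff[symmetric]) auto
  then show ?thesis
    by (simp add: pdQ_def[abs_def])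
qed

text \<open>Substituting x = Q(u) turns du into g(x) dx. Since \<open>h\<close> is arbitrary, the
  identity determines the law of \<open>pdQ g\<close> under the uniform measure.\<close>

lemma nn_integral_pdQ:
  assumes "is_density g" and [measurable]: "h \<in> borel_measurable borel"
  shows "(\<integral>\<^sup>+u. h (pdQ g u) \<partial>unit_measure)
    = (\<integral>\<^sup>+x. ennreal (g x) * h (g x / enn2real (power_integral g 2)) \<partial>lborel)"
proof -
  note [measurable] = is_densityD(1)[OF assms(1)] quantile_measurable_and_distr(1)[OF assms(1)]
  let ?k = "\<lambda>x. h (g x / enn2real (power_integral g 2))"
  have "(\<integral>\<^sup>+u. h (pdQ g u) \<partial>unit_measure) = (\<integral>\<^sup>+u. ?k (quantile (density_cdf g) u) \<partial>unit_measure)"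
    by (intro nn_integral_cong) (auto simp: pdQ_def space_restrict_space)
  also have "\<dots> = (\<integral>\<^sup>+x. ?k x \<partial>distr unit_measure borel (quantile (density_cdf g)))"
    by (rule nn_integral_distr[symmetric]) measurable
  also have "\<dots> = (\<integral>\<^sup>+x. ennreal (g x) * ?k x \<partial>lborel)"
    unfolding quantile_measurable_and_distr(2)[OF assms(1)] by (rule nn_integral_density) measurable
  finally show ?thesis .
qed

lemma nn_integral_unit_measure:
  assumes "\<And>x. x \<notin> {0<..<1} \<Longrightarrow> h x = 0"
  shows "integral\<^sup>N unit_measure h = integral\<^sup>N lborel h"
  by (subst nn_integral_restrict_space) (auto intro!: nn_integral_cong simp: indicator_def assms)

lemma pdQ_eq_0: "u \<notin> {0<..<1} \<Longrightarrow> pdQ g u = 0"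
  by (auto simp: pdQ_def)

text \<open>The identity as test function in \<open>nn_integral_pdQ\<close> gives the integral of
  g^2 / kappa, which is 1 because kappa is positive and finite.\<close>

lemma is_density_pdQ:
  assumes g: "is_density g" and fin: "power_integral g 2 < \<infinity>"
  shows "is_density (pdQ g)"
proof -
  note [measurable] = is_densityD(1)[OF g]
  define k where "k = enn2real (power_integral g 2)"
  have k: "power_integral g 2 = ennreal k" "0 < k"
    using fin power_integral_pos[OF g, of 2] by (auto simp: k_def enn2real_positive_iff)
  have "power_integral (pdQ g) 1 = (\<integral>\<^sup>+u. ennreal (pdQ g u) \<partial>unit_measure)"
    unfolding power_integral_def by (subst nn_integral_unit_measure) (auto simp: pdQ_eq_0)
  also have "\<dots> = (\<integral>\<^sup>+x. ennreal (g x) * ennreal (g x / k) \<partial>lborel)"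
    unfolding k_def by (rule nn_integral_pdQ[OF g]) auto
  also have "\<dots> = (\<integral>\<^sup>+x. ennreal (g x ^ 2) / ennreal k \<partial>lborel)"
    using k is_densityD(2)[OF g]
    by (intro nn_integral_cong) (simp add: divide_ennreal ennreal_mult[symmetric] power2_eq_square)
  also have "\<dots> = power_integral g 2 / ennreal k"
    by (subst nn_integral_divide) (auto simp: power_integral_def)
  also have "\<dots> = 1"
    using k by (simp add: divide_ennreal)
  finally show ?thesis
    using pdQ_measurable[OF g] is_densityD(2)[OF g] by (auto simp: is_density_iff pdQ_def)
qed

section \<open>The law of the iterates in terms of powers of \<open>f\<close>\<close>

text \<open>An infinite integral yields 0. This happens for \<open>n = 0\<close>, where the
  integrand is 1 on the whole line, so positivity is only claimed for \<open>0 < n\<close>.\<close>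

definition moment :: "(real \<Rightarrow> real) \<Rightarrow> nat \<Rightarrow> real" where
  "moment f n = enn2real (power_integral f n)"

text \<open>The law of the rescaled \<open>f\<close> under the tilted measure is encoded by its
  integrals against test functions \<open>h\<close>, so that no image measure has to be
  formed.\<close>

definition tilted_integral :: "(real \<Rightarrow> real) \<Rightarrow> nat \<Rightarrow> (real \<Rightarrow> ennreal) \<Rightarrow> ennreal" where
  "tilted_integral f n h =
     (\<integral>\<^sup>+x. ennreal (f x ^ n / moment f n) * h (f x / (moment f (n + 1) / moment f n)) \<partial>lborel)"

lemma pdQ_iter_Suc: "pdQ_iter (Suc n) f = pdQ (pdQ_iter n f)"
  by (simp add: pdQ_iter_def)

lemma moment_pos_if_finite:
  assumes "is_density f" "power_integral f n < \<infinity>" "0 < n"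
  shows "0 < moment f n" "power_integral f n = ennreal (moment f n)"
  using power_integral_pos[OF assms(1,3)] assms(2) by (auto simp: moment_def enn2real_positive_iff)

lemma is_density_moment_1: "is_density f \<Longrightarrow> moment f (Suc 0) = 1"
  by (simp add: is_density_iff moment_def)

text \<open>The law of \<open>g\<close> is used twice. The test function t^2 evaluates the
  normalising constant kappa of \<open>g\<close>; the test function t h(t / kappa) absorbs the extra
  factor \<open>g\<close> that \<open>nn_integral_pdQ\<close> produces and raises the tilt from
  \<open>N\<close> to \<open>N + 1\<close>.\<close>

lemma pdQ_iter_law_step:
  assumes f: "is_density f" and g: "is_density g" and g0: "\<And>x. x \<notin> {0<..<1} \<Longrightarrow> g x = 0"
    and N: "0 < N" "power_integral f N < \<infinity>" "power_integral f (N + 1) < \<infinity>"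
    and law: "\<And>h. h \<in> borel_measurable borel \<Longrightarrow>
      (\<integral>\<^sup>+u. h (g u) \<partial>unit_measure) = tilted_integral f N h"
    and fin: "power_integral g 2 < \<infinity>"
  shows "power_integral f (N + 2) < \<infinity>"
    and "h \<in> borel_measurable borel \<Longrightarrow>
      (\<integral>\<^sup>+u. h (pdQ g u) \<partial>unit_measure) = tilted_integral f (N + 1) h"
proof -
  note [measurable] = is_densityD(1)[OF f]
  have nn: "0 \<le> f x" for x by (rule is_densityD(2)[OF f])
  define a b where "a = moment f N" and "b = moment f (N + 1)"
  have pos: "0 < a" "0 < b"
    using moment_pos_if_finite(1)[OF f] N by (auto simp: a_def b_def)
  have "power_integral g 2 = (\<integral>\<^sup>+u. ennreal (g u ^ 2) \<partial>unit_measure)"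
    unfolding power_integral_def by (subst nn_integral_unit_measure) (auto simp: g0)
  also have "\<dots> = tilted_integral f N (\<lambda>t. ennreal (t ^ 2))"
    by (rule law) measurable
  also have "\<dots> = (\<integral>\<^sup>+x. ennreal (a / b ^ 2) * ennreal (f x ^ (N + 2)) \<partial>lborel)"
    unfolding tilted_integral_def a_def[symmetric] b_def[symmetric] using pos nn
    by (intro nn_integral_cong)
       (simp add: ennreal_mult[symmetric] field_simps power2_eq_square)
  also have "\<dots> = ennreal (a / b ^ 2) * power_integral f (N + 2)"
    unfolding power_integral_def by (rule nn_integral_cmult) measurable
  finally have g2: "power_integral g 2 = ennreal (a / b ^ 2) * power_integral f (N + 2)" .
  show fin2: "power_integral f (N + 2) < \<infinity>"
    using fin pos unfolding g2 by (auto simp: ennreal_mult_less_top)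
  define c where "c = moment f (N + 2)"
  have c: "0 < c" "power_integral f (N + 2) = ennreal c"
    using moment_pos_if_finite[OF f fin2] by (auto simp: c_def)
  have k: "enn2real (power_integral g 2) = a * c / b ^ 2"
    unfolding g2 c(2) using pos c(1) by (simp add: ennreal_mult[symmetric])
  assume [measurable]: "h \<in> borel_measurable borel"
  have "(\<integral>\<^sup>+u. h (pdQ g u) \<partial>unit_measure)
      = (\<integral>\<^sup>+x. ennreal (g x) * h (g x / (a * c / b ^ 2)) \<partial>lborel)"
    by (simp add: nn_integral_pdQ[OF g] k)
  \<comment> \<open>Since \<open>g\<close> vanishes off the unit interval, this is again an integral
    over the uniform measure, to which \<open>law\<close> applies.\<close>
  also have "\<dots> = (\<integral>\<^sup>+u. ennreal (g u) * h (g u / (a * c / b ^ 2)) \<partial>unit_measure)"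
    by (subst nn_integral_unit_measure) (auto simp: g0)
  also have "\<dots> = tilted_integral f N (\<lambda>t. ennreal t * h (t / (a * c / b ^ 2)))"
    by (rule law) measurable
  also have "\<dots> = tilted_integral f (N + 1) h"
  proof -
    \<comment> \<open>The factor y / (b / a) promotes the weight to the next power, and division by
      kappa replaces the scale b / a by c / b.\<close>
    have "ennreal (y ^ N / a) * (ennreal (y / (b / a)) * h (y / (b / a) / (a * c / b ^ 2)))
        = ennreal (y ^ (N + 1) / b) * h (y / (c / b))" if "0 \<le> y" for y
    proof -
      have "y ^ N / a * (y / (b / a)) = y ^ (N + 1) / b"
        and "y / (b / a) / (a * c / b ^ 2) = y / (c / b)"
        using pos c(1) by (simp_all add: field_simps power2_eq_square)
      then show ?thesis
        using pos that by (simp add: mult.assoc[symmetric] ennreal_mult[symmetric] del: power_Suc)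
    qed
    then show ?thesis
      unfolding tilted_integral_def using nn
      by (simp add: a_def b_def c_def numeral_2_eq_2)
  qed
  finally show "(\<integral>\<^sup>+u. h (pdQ g u) \<partial>unit_measure) = tilted_integral f (N + 1) h" .
qed

text \<open>Finiteness of the \<open>\<mu>\<^sub>k\<close> has to be carried along: it comes from that of \<open>\<kappa>\<^sub>n\<close> through
  \<open>\<kappa>\<^sub>n = \<mu>\<^sub>n \<mu>\<^sub>n\<^sub>+\<^sub>2 / \<mu>\<^sub>n\<^sub>+\<^sub>1\<^sup>2\<close>.\<close>

lemma pdQ_iter_law:
  assumes f: "is_density f" and ord: "infinite_star_order f"
  shows "power_integral f (Suc n) < \<infinity> \<and> power_integral f (Suc (Suc n)) < \<infinity> \<and>
    is_density (pdQ_iter (Suc n) f) \<and>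
    (\<forall>h \<in> borel_measurable borel.
      (\<integral>\<^sup>+u. h (pdQ_iter (Suc n) f u) \<partial>unit_measure) = tilted_integral f (Suc n) h)"
proof (induction n)
  case 0
  have fin: "power_integral f 2 < \<infinity>"
    using ord by (auto simp: infinite_star_order_def pdQ_iter_def dest!: spec[of _ 1])
  \<comment> \<open>As \<open>moment f 1\<close> is 1, the first tilt has density \<open>f\<close>
    itself and \<open>nn_integral_pdQ\<close> is already the claim.\<close>
  show ?case
    using fin is_density_pdQ[OF f fin] is_density_moment_1[OF f] f
    by (auto simp: pdQ_iter_def nn_integral_pdQ[OF f] tilted_integral_def moment_def numeral_2_eq_2
        is_density_iff)
next
  case (Suc n)
  let ?g = "pdQ_iter (Suc n) f"
  have g: "is_density ?g" using Suc by simp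
  have g0: "?g x = 0" if "x \<notin> {0<..<1}" for x
    unfolding pdQ_iter_Suc by (rule pdQ_eq_0[OF that])
  \<comment> \<open>This is part of the existence of the next iterate, with index
    \<open>Suc (Suc n)\<close>.\<close>
  have fin: "power_integral ?g 2 < \<infinity>"
    using ord unfolding infinite_star_order_def
    by (metis le_add1 pdQ_iter_exists.simps(2) plus_1_eq_Suc)
  note step = pdQ_iter_law_step[OF f g g0, where N = "Suc n", OF _ _ _ _ _ fin]
  show ?case
    using Suc step is_density_pdQ[OF g fin] by (simp add: pdQ_iter_Suc[of "Suc n"])
qed

section \<open>Moments and even central moments of the iterates\<close>

definition iter_moment :: "(real \<Rightarrow> real) \<Rightarrow> nat \<Rightarrow> nat \<Rightarrow> real" where
  "iter_moment f n k = moment f (n + k) * moment f n ^ k / (moment f n * moment f (n + 1) ^ k)"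

context
  fixes f
  assumes f: "is_density f" and ord: "infinite_star_order f"
begin

lemma power_integral_finite: "0 < n \<Longrightarrow> power_integral f n < \<infinity>"
  using pdQ_iter_law[OF f ord, of "n - 1"] by simp

lemma power_integral_eq_moment: "0 < n \<Longrightarrow> power_integral f n = ennreal (moment f n)"
  by (rule moment_pos_if_finite(2)[OF f power_integral_finite])

lemma moment_pos: "0 < n \<Longrightarrow> 0 < moment f n"
  by (rule moment_pos_if_finite(1)[OF f power_integral_finite])

lemma is_density_pdQ_iter: "0 < n \<Longrightarrow> is_density (pdQ_iter n f)"
  using pdQ_iter_law[OF f ord, of "n - 1"] by simp

lemma nn_integral_pdQ_iter:
  "0 < n \<Longrightarrow> h \<in> borel_measurable borel \<Longrightarrow>
    (\<integral>\<^sup>+u. h (pdQ_iter n f u) \<partial>unit_measure) = tilted_integral f n h"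
  using pdQ_iter_law[OF f ord, of "n - 1"] by simp

lemma iter_moment_pos: "0 < n \<Longrightarrow> 0 < iter_moment f n k"
  by (simp add: iter_moment_def moment_pos)

text \<open>This is the law of the iterate with test function t^k. The Bochner form includes
  integrability, which allows signed sums of moments to be integrated term by term.\<close>

lemma has_integral_pdQ_iter_power:
  assumes n: "0 < n"
  shows "has_bochner_integral unit_measure (\<lambda>u. pdQ_iter n f u ^ k) (iter_moment f n k)"
proof (rule has_bochner_integral_nn_integral)
  note [measurable] = is_densityD(1)[OF f] is_densityD(1)[OF is_density_pdQ_iter[OF n]]
  have nn: "0 \<le> f x" for x by (rule is_densityD(2)[OF f])
  define a b where "a = moment f n" and "b = moment f (n + 1)"
  have pos: "0 < a" "0 < b"
    using moment_pos n by (auto simp: a_def b_def)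
  show "(\<lambda>u. pdQ_iter n f u ^ k) \<in> borel_measurable unit_measure"
    by (intro measurable_restrict_space1) measurable
  show "AE u in unit_measure. 0 \<le> pdQ_iter n f u ^ k"
    using is_densityD(2)[OF is_density_pdQ_iter[OF n]] by simp
  show "0 \<le> iter_moment f n k"
    using iter_moment_pos[OF n] by (rule less_imp_le)
  have "(\<integral>\<^sup>+u. ennreal (pdQ_iter n f u ^ k) \<partial>unit_measure)
      = tilted_integral f n (\<lambda>t. ennreal (t ^ k))"
    by (rule nn_integral_pdQ_iter[OF n]) measurable
  also have "\<dots> = (\<integral>\<^sup>+x. ennreal (a ^ k / (a * b ^ k)) * ennreal (f x ^ (n + k)) \<partial>lborel)"
    unfolding tilted_integral_def a_def[symmetric] b_def[symmetric] using pos nn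
    by (intro nn_integral_cong)
       (simp add: ennreal_mult[symmetric] field_simps power_add)
  also have "\<dots> = ennreal (a ^ k / (a * b ^ k)) * power_integral f (n + k)"
    unfolding power_integral_def by (rule nn_integral_cmult) measurable
  also have "\<dots> = ennreal (iter_moment f n k)"
    using pos n moment_pos[of "n + k"]
    by (simp add: power_integral_eq_moment ennreal_mult[symmetric] iter_moment_def a_def b_def field_simps)
  finally show "(\<integral>\<^sup>+u. ennreal (pdQ_iter n f u ^ k) \<partial>unit_measure) = ennreal (iter_moment f n k)" .
qed

text \<open>The even exponent removes the absolute value, so the integrand is a polynomial in the
  iterate.\<close>

lemma has_integral_pdQ_iter_minus_1:
  assumes n: "0 < n"
  shows "has_bochner_integral unit_measure (\<lambda>u. \<bar>pdQ_iter n f u - 1\<bar> ^ (2 * p))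
    (\<Sum>j\<le>2 * p. of_nat (2 * p choose j) * iter_moment f n j * (- 1) ^ (2 * p - j))"
proof -
  have *: "\<bar>t - 1\<bar> ^ (2 * p) = (\<Sum>j\<le>2 * p. of_nat (2 * p choose j) * t ^ j * (- 1) ^ (2 * p - j))"
    for t :: real
    using binomial_ring[of t "- 1" "2 * p"] by (simp add: power_mult)
  show ?thesis
    unfolding *
    by (intro has_bochner_integral_sum has_bochner_integral_mult_left has_bochner_integral_mult_right
        has_integral_pdQ_iter_power[OF n])
qed

lemma nn_integral_pdQ_iter_minus_1:
  assumes n: "0 < n"
  shows "(\<integral>\<^sup>+u. ennreal (\<bar>pdQ_iter n f u - 1\<bar> ^ (2 * p)) \<partial>unit_measure)
    = ennreal (\<Sum>j\<le>2 * p. of_nat (2 * p choose j) * iter_moment f n j * (- 1) ^ (2 * p - j))"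
  using nn_integral_eq_integral[OF integrable.intros[OF has_integral_pdQ_iter_minus_1[OF n]]]
  by (simp add: has_bochner_integral_integral_eq[OF has_integral_pdQ_iter_minus_1[OF n]])

lemma iter_moment_0_1_2:
  assumes "0 < n"
  shows "iter_moment f n 0 = 1" "iter_moment f n (Suc 0) = 1"
    "iter_moment f n 2 = moment f n * moment f (n + 2) / moment f (n + 1) ^ 2"
  using moment_pos[OF assms] moment_pos[of "n + 1"]
  by (simp_all add: iter_moment_def power2_eq_square)

text \<open>The difference of the two sides is the integral of a square. The bound ensures that
  \<open>ennreal\<close> does not truncate this difference.\<close>

lemma iter_moment_2_ge_1:
  assumes n: "0 < n"
  shows "1 \<le> iter_moment f n 2"
proof -
  have "0 \<le> (\<integral>u. \<bar>pdQ_iter n f u - 1\<bar> ^ (2 * 1) \<partial>unit_measure)"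
    by (rule integral_nonneg_AE) simp
  also have "\<dots> = iter_moment f n 2 - 1"
    using has_bochner_integral_integral_eq[OF has_integral_pdQ_iter_minus_1[OF n, of 1]]
    by (simp add: iter_moment_0_1_2(1,2)[OF n] numeral_2_eq_2)
  finally show ?thesis by simp
qed

lemma iter_moment_tendsto_1:
  assumes "(\<lambda>n. iter_moment f n 2) \<longlonglongrightarrow> 1"
  shows "(\<lambda>n. iter_moment f n k) \<longlonglongrightarrow> 1"
proof -
  \<comment> \<open>The scale of the \<open>n\<close>-th tilt; the hypothesis says that its
    consecutive quotients tend to 1.\<close>
  define R where "R n = moment f (n + 1) / moment f n" for n
  have Rpos: "0 < R n" if "0 < n" for n
    using that by (simp add: R_def moment_pos)
  have quot: "(\<lambda>n. R (n + 1) / R n) \<longlonglongrightarrow> 1"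
  proof (rule Lim_transform_eventually[OF assms])
    show "\<forall>\<^sub>F n in sequentially. iter_moment f n 2 = R (n + 1) / R n"
      using eventually_gt_at_top[of 0]
      by eventually_elim (simp add: iter_moment_0_1_2 R_def power2_eq_square)
  qed
  \<comment> \<open>For fixed \<open>k\<close> this telescopes into \<open>k\<close> consecutive
    quotients, each tending to 1.\<close>
  have shift: "(\<lambda>n. R (n + k) / R n) \<longlonglongrightarrow> 1" for k
  proof (induction k)
    case 0
    show ?case
      by (rule tendsto_eventually, use eventually_gt_at_top[of 0] in eventually_elim)
         (use Rpos in \<open>auto simp: less_imp_neq[symmetric]\<close>)
  next
    case (Suc k)
    have "(\<lambda>n. R (n + k + 1) / R (n + k) * (R (n + k) / R n)) \<longlonglongrightarrow> 1 * 1"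
      by (intro tendsto_mult Suc LIMSEQ_ignore_initial_segment[OF quot, of k])
    then have "(\<lambda>n. R (n + k + 1) / R (n + k) * (R (n + k) / R n)) \<longlonglongrightarrow> 1"
      by simp
    then show ?case
    proof (rule Lim_transform_eventually)
      show "\<forall>\<^sub>F n in sequentially.
          R (n + k + 1) / R (n + k) * (R (n + k) / R n) = R (n + Suc k) / R n"
        using eventually_gt_at_top[of 0]
      proof eventually_elim
        case (elim n)
        then show ?case using Rpos[of "n + k"] by simp
      qed
    qed
  qed
  show ?thesis
  proof (induction k)
    case 0
    show ?case
      by (rule tendsto_eventually, use eventually_gt_at_top[of 0] in eventually_elim)
         (simp add: iter_moment_0_1_2)
  next
    case (Suc k)
    \<comment> \<open>For positive \<open>n\<close> the product is exactly the moment of order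
      \<open>Suc k\<close>.\<close>
    have "(\<lambda>n. iter_moment f n k * (R (n + k) / R n)) \<longlonglongrightarrow> 1"
      using tendsto_mult[OF Suc shift[of k]] by simp
    then show ?case
    proof (rule Lim_transform_eventually)
      show "\<forall>\<^sub>F n in sequentially. iter_moment f n k * (R (n + k) / R n) = iter_moment f n (Suc k)"
        using eventually_gt_at_top[of 0]
      proof eventually_elim
        case (elim n)
        then show ?case
          using moment_pos[of n] moment_pos[of "n + k"] moment_pos[of "n + 1"]
          by (simp add: iter_moment_def R_def field_simps)
      qed
    qed
  qed
qed

lemma even_power_tendsto_0:
  assumes lim: "(\<lambda>n. iter_moment f n 2) \<longlonglongrightarrow> 1" and p: "0 < p"
  shows "(\<lambda>n. \<integral>\<^sup>+u. ennreal (\<bar>pdQ_iter n f u - 1\<bar> ^ (2 * p)) \<partial>unit_measure) \<longlonglongrightarrow> 0"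
proof -
  have "(\<lambda>n. \<Sum>j\<le>2 * p. of_nat (2 * p choose j) * iter_moment f n j * (- 1) ^ (2 * p - j))
      \<longlonglongrightarrow> (\<Sum>j\<le>2 * p. of_nat (2 * p choose j) * 1 * (- 1) ^ (2 * p - j))"
    by (intro tendsto_intros iter_moment_tendsto_1[OF lim])
  \<comment> \<open>The sum expands (1 - 1)^(2p), which is 0 because \<open>p\<close> is
    positive.\<close>
  also have "(\<Sum>j\<le>2 * p. of_nat (2 * p choose j) * 1 * (- 1) ^ (2 * p - j)) = (0::real)"
    using binomial_ring[of "1::real" "-1" "2 * p"] p by (simp add: zero_power)
  finally have "(\<lambda>n. ennreal (\<Sum>j\<le>2 * p. of_nat (2 * p choose j) * iter_moment f n j
      * (- 1) ^ (2 * p - j))) \<longlonglongrightarrow> ennreal 0"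
    by (rule tendsto_ennrealI)
  then have "(\<lambda>n. ennreal (\<Sum>j\<le>2 * p. of_nat (2 * p choose j) * iter_moment f n j
      * (- 1) ^ (2 * p - j))) \<longlonglongrightarrow> 0"
    by simp
  then show ?thesis
  proof (rule Lim_transform_eventually)
    show "\<forall>\<^sub>F n in sequentially. ennreal (\<Sum>j\<le>2 * p. of_nat (2 * p choose j) * iter_moment f n j
        * (- 1) ^ (2 * p - j)) = (\<integral>\<^sup>+u. ennreal (\<bar>pdQ_iter n f u - 1\<bar> ^ (2 * p)) \<partial>unit_measure)"
      using eventually_gt_at_top[of 0]
      by eventually_elim (simp add: nn_integral_pdQ_iter_minus_1)
  qed
qed

end

section \<open>From even powers to arbitrary positive exponents\<close>

text \<open>Split at the threshold \<open>e\<close>: below it the first term dominates; above it,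
  t^(r - q) is at most e^(r - q) because the exponent is not positive.\<close>

lemma powr_le_add_power:
  fixes t e r :: real
  assumes "0 \<le> t" "0 < e" "0 < r" "r \<le> real q"
  shows "t powr r \<le> e powr r + e powr (r - real q) * t ^ q"
proof (cases "t \<le> e")
  case True
  then have "t powr r \<le> e powr r"
    using assms by (intro powr_mono2) auto
  moreover have "0 \<le> e powr (r - real q) * t ^ q" using assms by simp
  ultimately show ?thesis by simp
next
  case False
  then have t: "0 < t" using assms by simp
  have "t powr r = t powr (r - real q) * t ^ q"
    using t by (simp add: powr_realpow[symmetric] powr_add[symmetric])
  also have "\<dots> \<le> e powr (r - real q) * t ^ q"
    using False assms t by (intro mult_right_mono powr_mono2') auto
  also have "\<dots> \<le> e powr r + e powr (r - real q) * t ^ q" by simp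
  finally show ?thesis .
qed

text \<open>Integrating the split bound over a probability space leaves the constant e^r, which can
  be made small, plus a fixed multiple of the integral that tends to 0. Exponents below 1 are
  covered as well.\<close>

lemma (in prob_space) powr_integral_tendsto_0:
  fixes X :: "nat \<Rightarrow> 'a \<Rightarrow> real"
  assumes meas: "\<forall>\<^sub>F n in sequentially. X n \<in> borel_measurable M"
    and lim: "(\<lambda>n. \<integral>\<^sup>+x. ennreal (\<bar>X n x\<bar> ^ q) \<partial>M) \<longlonglongrightarrow> 0"
    and r: "0 < r" "r \<le> real q"
  shows "(\<lambda>n. \<integral>\<^sup>+x. ennreal (\<bar>X n x\<bar> powr r) \<partial>M) \<longlonglongrightarrow> 0"
proof (rule order_tendstoI)
  fix d :: ennreal
  assume "0 < d"
  \<comment> \<open>The bound \<open>d\<close> may be infinite, so a real number below it is chosen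
    first.\<close>
  obtain d' where d': "0 < d'" "ennreal d' < d"
  proof -
    obtain z where "0 < z" "z < d" using dense[OF \<open>0 < d\<close>] by blast
    moreover from \<open>z < d\<close> have "z < top" by (rule order.strict_trans2) simp
    ultimately show thesis
      by (intro that[of "enn2real z"]) (auto simp: enn2real_positive_iff)
  qed
  define e where "e = d' powr (1 / r)"
  have e: "0 < e" "e powr r = d'"
    using d'(1) r by (auto simp: e_def powr_powr)
  define C where "C = e powr (r - real q)"
  have "(\<lambda>n. ennreal d' + ennreal C * (\<integral>\<^sup>+x. ennreal (\<bar>X n x\<bar> ^ q) \<partial>M)) \<longlonglongrightarrow> ennreal d' + ennreal C * 0"
    by (intro tendsto_add tendsto_const ennreal_tendsto_cmult lim) simp
  then have "\<forall>\<^sub>F n in sequentially. ennreal d' + ennreal C * (\<integral>\<^sup>+x. ennreal (\<bar>X n x\<bar> ^ q) \<partial>M) < d"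
    using d'(2) by (auto dest: order_tendstoD(2))
  then show "\<forall>\<^sub>F n in sequentially. (\<integral>\<^sup>+x. ennreal (\<bar>X n x\<bar> powr r) \<partial>M) < d"
    using meas
  proof eventually_elim
    case (elim n)
    note [measurable] = elim(2)
    have "(\<integral>\<^sup>+x. ennreal (\<bar>X n x\<bar> powr r) \<partial>M)
        \<le> (\<integral>\<^sup>+x. ennreal d' + ennreal C * ennreal (\<bar>X n x\<bar> ^ q) \<partial>M)"
    proof (rule nn_integral_mono)
      fix x
      have "\<bar>X n x\<bar> powr r \<le> d' + C * \<bar>X n x\<bar> ^ q"
        using powr_le_add_power[of "\<bar>X n x\<bar>" e r q] r e by (simp add: C_def)
      then show "ennreal (\<bar>X n x\<bar> powr r) \<le> ennreal d' + ennreal C * ennreal (\<bar>X n x\<bar> ^ q)"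
        using d'(1) by (simp add: C_def ennreal_mult[symmetric] ennreal_plus[symmetric] ennreal_leI
            del: ennreal_plus)
    qed
    also have "\<dots> = ennreal d' + ennreal C * (\<integral>\<^sup>+x. ennreal (\<bar>X n x\<bar> ^ q) \<partial>M)"
      by (subst nn_integral_add) (auto simp: nn_integral_cmult emeasure_space_1)
    finally show ?case using elim(1) by simp
  qed
qed simp

section \<open>Equivalence of the three modes of convergence\<close>

theorem theorem2p4:
  fixes f :: "real \<Rightarrow> real"
  assumes "f \<in> positive_densities"
    and "infinite_star_order f"
  shows "(((\<lambda>n. \<integral>\<^sup>+x\<in>{0<..<1}. ennreal (\<bar>pdQ_iter n f x - 1\<bar> ^ 2) \<partial>lborel) \<longlonglongrightarrow> 0)
        \<longleftrightarrow> (\<forall>r::real. 0 < r \<longrightarrow>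
            (\<lambda>n. \<integral>\<^sup>+x\<in>{0<..<1}. ennreal (\<bar>pdQ_iter n f x - 1\<bar> powr r) \<partial>lborel) \<longlonglongrightarrow> 0))
    \<and> (((\<lambda>n. \<integral>\<^sup>+x\<in>{0<..<1}. ennreal (\<bar>pdQ_iter n f x - 1\<bar> ^ 2) \<partial>lborel) \<longlonglongrightarrow> 0)
        \<longleftrightarrow> ((\<lambda>n. power_integral f n * power_integral f (n + 2) / power_integral f (n + 1) ^ 2)
              \<longlonglongrightarrow> 1))"
proof -
  have f: "is_density f"
    using assms(1) by (simp add: positive_densities_def is_density_def)
  note ord = assms(2)
  have unit: "(\<integral>\<^sup>+x\<in>{0<..<1}. h x \<partial>lborel) = integral\<^sup>N unit_measure h" for h :: "real \<Rightarrow> ennreal"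
    by (subst nn_integral_restrict_space) auto
  let ?I = "\<lambda>n. \<integral>\<^sup>+u. ennreal (\<bar>pdQ_iter n f u - 1\<bar> ^ 2) \<partial>unit_measure"
  let ?J = "\<lambda>r n. \<integral>\<^sup>+u. ennreal (\<bar>pdQ_iter n f u - 1\<bar> powr r) \<partial>unit_measure"
  let ?L = "(\<lambda>n. iter_moment f n 2) \<longlonglongrightarrow> 1"
  let ?Q = "\<lambda>n. power_integral f n * power_integral f (n + 2) / power_integral f (n + 1) ^ 2"
  have Ieq: "?I n = ennreal (iter_moment f n 2 - 1)" if "0 < n" for n
    using nn_integral_pdQ_iter_minus_1[OF f ord that, of 1]
    by (simp add: iter_moment_0_1_2(1,2)[OF f ord that] numeral_2_eq_2)
  have Qeq: "?Q n = ennreal (iter_moment f n 2)" if "0 < n" for n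
    using that moment_pos[OF f ord, of n] moment_pos[OF f ord, of "n + 1"] moment_pos[OF f ord, of "n + 2"]
    by (simp add: iter_moment_0_1_2[OF f ord that] power_integral_eq_moment[OF f ord]
        ennreal_mult[symmetric] ennreal_power divide_ennreal)
  \<comment> \<open>Limits of \<open>ennreal\<close> values and of real values agree here because
    the real sequence is eventually nonnegative.\<close>
  have Q_iff: "?Q \<longlonglongrightarrow> 1 \<longleftrightarrow> ?L"
  proof -
    have "?Q \<longlonglongrightarrow> 1 \<longleftrightarrow> (\<lambda>n. ennreal (iter_moment f n 2)) \<longlonglongrightarrow> ennreal 1"
      by (subst ennreal_1, rule tendsto_cong, use eventually_gt_at_top[of 0] in eventually_elim) (rule Qeq)
    also have "\<dots> \<longleftrightarrow> ?L"
      by (rule tendsto_ennreal_iff, use eventually_gt_at_top[of 0] in eventually_elim)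
         (auto intro: less_imp_le iter_moment_pos[OF f ord])
    finally show ?thesis .
  qed
  have I_iff: "?I \<longlonglongrightarrow> 0 \<longleftrightarrow> ?L"
  proof -
    have "?I \<longlonglongrightarrow> 0 \<longleftrightarrow> (\<lambda>n. ennreal (iter_moment f n 2 - 1)) \<longlonglongrightarrow> ennreal 0"
      by (subst ennreal_0, rule tendsto_cong, use eventually_gt_at_top[of 0] in eventually_elim) (rule Ieq)
    also have "\<dots> \<longleftrightarrow> (\<lambda>n. iter_moment f n 2 - 1) \<longlonglongrightarrow> 0"
      by (rule tendsto_ennreal_iff, use eventually_gt_at_top[of 0] in eventually_elim)
         (use iter_moment_2_ge_1[OF f ord] in auto)
    also have "\<dots> \<longleftrightarrow> ?L"
      by (simp add: LIM_zero_iff)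
    finally show ?thesis .
  qed
  have J: "?J r \<longlonglongrightarrow> 0" if L: ?L and r: "0 < r" for r
  proof -
    \<comment> \<open>Any positive \<open>p\<close> with r <= 2p serves: the even power 2p then
      controls the exponent \<open>r\<close>.\<close>
    define p where "p = nat \<lceil>r\<rceil>"
    have p: "0 < p" "r \<le> real (2 * p)"
      using r by (auto simp: p_def) linarith
    show ?thesis
    proof (rule prob_space.powr_integral_tendsto_0[OF prob_space_unit_measure _ even_power_tendsto_0[OF f ord L p(1)] r p(2)])
      show "\<forall>\<^sub>F n in sequentially. (\<lambda>u. pdQ_iter n f u - 1) \<in> borel_measurable unit_measure"
        using eventually_gt_at_top[of 0]
      proof eventually_elim
        case (elim n)
        note [measurable] = is_densityD(1)[OF is_density_pdQ_iter[OF f ord elim]]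
        show ?case by (intro measurable_restrict_space1) measurable
      qed
    qed
  qed
  \<comment> \<open>The second statement at \<open>r = 2\<close> is the first one, which gives the
    converse implication.\<close>
  have "?J 2 = ?I"
    by simp
  then have "?I \<longlonglongrightarrow> 0 \<longleftrightarrow> (\<forall>r>0. ?J r \<longlonglongrightarrow> 0)"
    using J I_iff by (metis zero_less_numeral)
  then show ?thesis
    unfolding unit using I_iff Q_iff by blast
qed

end
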